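(* There exist $\varepsilon>0$ and a constant $c\in[1/2,1-\varepsilon]$ such that $\operatorname{sat}(k)\le 2^{(1-\varepsilon)k}$ for every positive integer $k$ and $\operatorname{sat}(k)=2^{(1+o(1))ck}$ as $k\to\infty$.
   Context: For a set $X$, a collection $\mathcal{F}\subseteq\mathcal{P}(X)$ is a $k$-Sperner system if it contains no $(k+1)$-chain, i.e. no sets $A_1\subsetneq\dots\subsetneq A_{k+1}$ all in $\mathcal{F}$. It is a saturated $k$-Sperner system if it is a $k$-Sperner system and for every $S\in\mathcal{P}(X)\setminus\mathcal{F}$ the collection $\mathcal{F}\cup\{S\}$ contains a $(k+1)$-chain. $\operatorname{sat}(n,k)$ denotes the minimum size of a saturated $k$-Sperner system in $\mathcal{P}(X)$ with $|X|=n$; for fixed $k$ it is constant for all sufficiently large $n$, and $\operatorname{sat}(k):=\lim_{n\to\infty}\operatorname{sat}(n,k)$. *)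

theory Defs
  imports Complex_Main "HOL-Library.Landau_Symbols"
begin

definition has_chain :: "nat \<Rightarrow> 'a set set \<Rightarrow> bool" where
  "has_chain m F \<longleftrightarrow>
     (\<exists>A :: nat \<Rightarrow> 'a set. (\<forall>i\<in>{1..m}. A i \<in> F) \<and> (\<forall>i\<in>{1..<m}. A i \<subset> A (Suc i)))"

definition Sperner_system :: "nat \<Rightarrow> 'a set \<Rightarrow> 'a set set \<Rightarrow> bool" where
  "Sperner_system k X F \<longleftrightarrow> F \<subseteq> Pow X \<and> \<not> has_chain (k + 1) F"

definition saturated_Sperner_system :: "nat \<Rightarrow> 'a set \<Rightarrow> 'a set set \<Rightarrow> bool" where
  "saturated_Sperner_system k X F \<longleftrightarrow>
     Sperner_system k X F \<and> (\<forall>S\<in>Pow X - F. has_chain (k + 1) (F \<union> {S}))"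

text \<open>The set below is a nonempty set of natural numbers (a maximal \<open>k\<close>-Sperner system in
  \<open>Pow X\<close> always exists), so its infimum is attained.  Every finite cardinality is realised by a
  set of natural numbers, so no ground set is lost by restricting to them.\<close>

definition sat :: "nat \<Rightarrow> nat \<Rightarrow> nat" where
  "sat n k = Inf {card F | (X :: nat set) F.
     finite X \<and> card X = n \<and> saturated_Sperner_system k X F}"

definition sat_lim :: "nat \<Rightarrow> real" where
  "sat_lim k = lim (\<lambda>n. real (sat n k))"

end

theory Submission imports Defs begin

text \<open>
  A family with few sets on a huge ground set has twins: two points that no member separates.
  Let \<open>S\<close> consist of the members that avoid the twins and \<open>M\<close> of the complements of the
  members that contain them. Adding just one of the twins to a set \<open>T\<close> never gives a member, so
  saturation says that the longest chain of \<open>S\<close> below \<open>T\<close> and the longest chain of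
  \<open>M\<close> below the complement of \<open>T\<close> have \<open>k\<close> members in total. This condition does not
  mention the ground set, so \<open>sat n k\<close> is eventually constant.

  Families on disjoint ground sets multiply by taking pairwise unions, and the longest chain of the
  product has one member less than those of the factors together. Hence
  \<open>log sat_lim (k + 2)\<close> is subadditive and Fekete's lemma yields \<open>c\<close>. The intervals from the
  top of a longest chain of \<open>S\<close> below \<open>T\<close> to the complement of the top of a longest chain of
  \<open>M\<close> below \<open>- T\<close> cover the cube and have codimension at least \<open>k - 2\<close>; hence
  \<open>|S| |M| \<ge> 2 ^ (k - 2)\<close> and \<open>c \<ge> 1/2\<close>. For \<open>k = 6\<close> a pair with 15 members on each side
  beats the power set of four points, and its products give \<open>c < 1\<close>.
\<close>

section \<open>Heights of set families\<close>

definition height :: "'a set set \<Rightarrow> nat" where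
  "height F = Max (card ` {C. subset.chain F C})"

lemma finite_chains: "finite F \<Longrightarrow> finite {C. subset.chain F C}"
  by (rule finite_subset[of _ "Pow F"]) (auto simp: subset_chain_def)

lemma finite_chain: "finite F \<Longrightarrow> subset.chain F C \<Longrightarrow> finite C"
  by (auto simp: subset_chain_def intro: finite_subset)

lemma subset_chain_subset: "subset.chain F C \<Longrightarrow> D \<subseteq> C \<Longrightarrow> D \<subseteq> G \<Longrightarrow> subset.chain G D"
  unfolding subset_chain_def by blast

lemma subset_chain_mono: "subset.chain F C \<Longrightarrow> F \<subseteq> G \<Longrightarrow> subset.chain G C"
  unfolding subset_chain_def by blast

lemma subset_chain_Un:
  assumes "subset.chain F C" "subset.chain F D" "\<And>A B. A \<in> C \<Longrightarrow> B \<in> D \<Longrightarrow> A \<subseteq> B"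
  shows "subset.chain F (C \<union> D)"
  using assms by (simp add: subset_chain_def ball_Un)

lemma card_le_height: "finite F \<Longrightarrow> subset.chain F C \<Longrightarrow> card C \<le> height F"
  unfolding height_def by (intro Max_ge) (auto simp: finite_chains)

lemma height_attained:
  assumes "finite F"
  obtains C where "subset.chain F C" "finite C" "card C = height F"
proof -
  have "height F \<in> card ` {C. subset.chain F C}"
    unfolding height_def using finite_chains[OF assms]
    by (intro Max_in) (auto intro: exI[of _ "{}"])
  then show thesis using that finite_chain[OF assms] by force
qed

lemma height_mono:
  assumes "finite G" "F \<subseteq> G"
  shows "height F \<le> height G"
proof -
  obtain C where C: "subset.chain F C" "card C = height F"
    using height_attained[OF finite_subset[OF assms(2,1)]] .
  have "C \<subseteq> G" using C(1) assms(2) by (auto simp: subset_chain_def)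
  then show ?thesis
    using card_le_height[OF assms(1) subset_chain_subset[OF C(1) order_refl]] C(2) by simp
qed

lemma height_empty [simp]: "height {} = 0"
  using height_attained[of "{}"] by (metis card.empty finite.emptyI subset_chain_def subset_empty)

lemma inj_on_chain_strict_mono:
  fixes g :: "'a set \<Rightarrow> 'b::linorder"
  assumes "subset.chain F C" "\<And>A B. A \<in> C \<Longrightarrow> B \<in> C \<Longrightarrow> A \<subset> B \<Longrightarrow> g A < g B"
  shows "inj_on g C"
proof (rule inj_onI, rule ccontr)
  fix A B assume "A \<in> C" "B \<in> C" "g A = g B" "A \<noteq> B"
  moreover have "A \<subset> B \<or> B \<subset> A" using assms(1) calculation unfolding subset_chain_def by blast
  ultimately show False using assms(2) by (metis less_irrefl)
qed

lemma height_image: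
  assumes "finite F" "inj_on f F"
    and comparable: "\<And>A B. A \<in> F \<Longrightarrow> B \<in> F \<Longrightarrow> f A \<subseteq> f B \<or> f B \<subseteq> f A \<longleftrightarrow> A \<subseteq> B \<or> B \<subseteq> A"
  shows "height (f ` F) = height F"
proof (rule antisym)
  obtain D where D: "subset.chain (f ` F) D" "card D = height (f ` F)"
    using height_attained assms(1) by (metis finite_imageI)
  then obtain C where C: "C \<subseteq> F" "D = f ` C" unfolding subset_chain_def by (meson subset_imageE)
  have "subset.chain F C"
    unfolding subset_chain_def
  proof (intro conjI ballI C(1))
    fix A B assume AB: "A \<in> C" "B \<in> C"
    then have "f A \<subseteq> f B \<or> f B \<subseteq> f A" using D(1) C(2) by (simp add: subset_chain_def)
    then show "A \<subseteq> B \<or> B \<subseteq> A" using comparable AB C(1) by blast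
  qed
  moreover have "card D = card C" using C assms(2) by (simp add: card_image inj_on_subset)
  ultimately show "height (f ` F) \<le> height F" using card_le_height[OF assms(1)] D(2) by metis
next
  obtain C where C: "subset.chain F C" "card C = height F" using height_attained[OF assms(1)] .
  then have "C \<subseteq> F" by (simp add: subset_chain_def)
  then have "subset.chain (f ` F) (f ` C)"
    using C(1) comparable by (auto simp: subset_chain_def subset_iff[of C])
  moreover have "card (f ` C) = card C"
    using assms(2) \<open>C \<subseteq> F\<close> by (simp add: card_image inj_on_subset)
  ultimately show "height F \<le> height (f ` F)"
    using card_le_height[of "f ` F" "f ` C"] assms(1) C(2) by simp
qed

lemma inj_on_compl: "F \<subseteq> Pow X \<Longrightarrow> inj_on ((-) X) F"
  by (intro inj_on_inverseI[of _ "(-) X"]) (auto simp: double_diff)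

lemma height_compl:
  assumes "finite F" "F \<subseteq> Pow X"
  shows "height ((-) X ` F) = height F"
proof (rule height_image[OF assms(1)])
  show "inj_on ((-) X) F" by (rule inj_on_compl[OF assms(2)])
qed (use assms(2) in blast)

lemma height_insert_le:
  assumes "finite F"
  shows "height (insert Z F) \<le>
    max (height F) (Suc (height {A\<in>F. A \<subset> Z} + height {A\<in>F. Z \<subset> A}))"
proof -
  obtain C where C: "subset.chain (insert Z F) C" "finite C" "card C = height (insert Z F)"
    using height_attained[of "insert Z F"] assms by auto
  show ?thesis
  proof (cases "Z \<in> C")
    case True
    let ?below = "{A\<in>C. A \<subset> Z}" and ?above = "{A\<in>C. Z \<subset> A}"
    have "C \<subseteq> insert Z (?below \<union> ?above)" using C(1) True by (auto simp: subset_chain_def)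
    then have "card C \<le> card (insert Z (?below \<union> ?above))" using C(2) by (intro card_mono) auto
    also have "\<dots> \<le> Suc (card (?below \<union> ?above))" using C(2) by (simp add: card_insert_if)
    also have "card (?below \<union> ?above) \<le> card ?below + card ?above" by (rule card_Un_le)
    also have "card ?below \<le> height {A\<in>F. A \<subset> Z}"
      using assms C(1)
      by (intro card_le_height subset_chain_subset[OF C(1)]) (auto simp: subset_chain_def)
    also have "card ?above \<le> height {A\<in>F. Z \<subset> A}"
      using assms C(1)
      by (intro card_le_height subset_chain_subset[OF C(1)]) (auto simp: subset_chain_def)
    finally show ?thesis using C(3) by simp
  next
    case False
    then have "subset.chain F C" using C(1) by (auto simp: subset_chain_def)
    then have "card C \<le> height F" by (rule card_le_height[OF assms])
    then show ?thesis using C(3) by simp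
  qed
qed

lemma Suc_height_le_height_insert:
  assumes "finite F"
  shows "Suc (height {A\<in>F. A \<subset> Z} + height {A\<in>F. Z \<subset> A}) \<le> height (insert Z F)"
proof -
  have "finite {A\<in>F. A \<subset> Z}" "finite {A\<in>F. Z \<subset> A}" using assms by simp_all
  note attained = this[THEN height_attained]
  obtain P where P: "subset.chain {A\<in>F. A \<subset> Z} P" "finite P" "card P = height {A\<in>F. A \<subset> Z}"
    using attained(1) .
  obtain Q where Q: "subset.chain {A\<in>F. Z \<subset> A} Q" "finite Q" "card Q = height {A\<in>F. Z \<subset> A}"
    using attained(2) .
  have PQ: "A \<in> P \<Longrightarrow> A \<subset> Z" "B \<in> Q \<Longrightarrow> Z \<subset> B" for A B
    using P(1) Q(1) by (auto simp: subset_chain_def)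
  have "subset.chain (insert Z F) P" using P(1) by (rule subset_chain_mono) blast
  moreover have "subset.chain (insert Z F) (insert Z Q)"
    using PQ(2) subset_chain_mono[OF Q(1), of "insert Z F"] by (auto simp: subset_chain_insert)
  ultimately have "subset.chain (insert Z F) (P \<union> insert Z Q)"
    by (rule subset_chain_Un) (use PQ in blast)
  then have "card (P \<union> insert Z Q) \<le> height (insert Z F)" using assms by (simp add: card_le_height)
  moreover have "Z \<notin> P \<union> Q" "P \<inter> Q = {}" using PQ by blast+
  ultimately show ?thesis using P(2,3) Q(2,3) by (simp add: card_Un_disjoint)
qed

lemma height_insert:
  assumes "finite F"
  shows "height (insert Z F) =
    max (height F) (Suc (height {A\<in>F. A \<subset> Z} + height {A\<in>F. Z \<subset> A}))"
proof (rule antisym[OF height_insert_le[OF assms]])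
  have "height F \<le> height (insert Z F)" using assms by (intro height_mono) auto
  then show "max (height F) (Suc (height {A\<in>F. A \<subset> Z} + height {A\<in>F. Z \<subset> A})) \<le> height (insert Z F)"
    using Suc_height_le_height_insert[OF assms] by simp
qed

lemma height_insert_le_Suc:
  assumes "finite F"
  shows "height (insert Z F) \<le> Suc (height F)"
proof -
  obtain C where C: "subset.chain (insert Z F) C" "finite C" "card C = height (insert Z F)"
    using height_attained[of "insert Z F"] assms by auto
  have "subset.chain F (C - {Z})" using C(1) by (auto simp: subset_chain_def)
  then have "card (C - {Z}) \<le> height F" by (rule card_le_height[OF assms])
  then show ?thesis using C(2,3) by (simp add: card_Diff_singleton_if split: if_splits)
qed

lemma height_Pow:
  assumes "finite A"
  shows "height (Pow A) = Suc (card A)"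
proof (rule antisym)
  obtain C where C: "subset.chain (Pow A) C" "card C = height (Pow A)"
    using height_attained assms by (metis finite_Pow_iff)
  have "card C \<le> card {..card A}"
  proof (rule card_inj_on_le)
    have sub: "C \<subseteq> Pow A" using C(1) by (simp add: subset_chain_def)
    show "inj_on card C"
      by (rule inj_on_chain_strict_mono[OF C(1)])
        (use sub assms in \<open>auto intro!: psubset_card_mono intro: finite_subset\<close>)
    show "card ` C \<subseteq> {..card A}" using sub assms by (auto intro: card_mono)
  qed simp
  then show "height (Pow A) \<le> Suc (card A)" using C(2) by simp
next
  show "Suc (card A) \<le> height (Pow A)"
    using assms
  proof induction
    case empty
    show ?case by (simp add: height_insert)
  next
    case (insert a A)
    have "{B\<in>Pow A. B \<subset> insert a A} = Pow A" using insert.hyps(2) by auto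
    then have "Suc (height (Pow A)) \<le> height (insert (insert a A) (Pow A))"
      using insert.hyps(1) by (simp add: height_insert)
    also have "\<dots> \<le> height (Pow (insert a A))" using insert.hyps(1) by (intro height_mono) auto
    finally show ?case using insert by simp
  qed
qed

lemma chain_of_has_chain:
  assumes "has_chain m F"
  obtains C where "subset.chain F C" "card C = m"
proof -
  obtain A where A: "\<And>i. i \<in> {1..m} \<Longrightarrow> A i \<in> F" "\<And>i. i \<in> {1..<m} \<Longrightarrow> A i \<subset> A (Suc i)"
    using assms unfolding has_chain_def by blast
  have less: "A i \<subset> A j" if "i \<in> {1..m}" "j \<in> {1..m}" "i < j" for i j
    by (rule lift_Suc_mono_less_ivl[of "{1..<m}" A, OF A(2)]) (use that in auto)
  then have "inj_on A {1..m}" by (metis inj_onI nat_neq_iff psubset_eq)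
  moreover have "A i \<subseteq> A j \<or> A j \<subseteq> A i" if "i \<in> {1..m}" "j \<in> {1..m}" for i j
    using less[OF that] less[OF that(2,1)] by (metis nat_neq_iff order_refl psubset_eq)
  then have "subset.chain F (A ` {1..m})" using A(1) unfolding subset_chain_def by blast
  ultimately show thesis using that by (simp add: card_image)
qed

lemma has_chain_card_of_chain: "finite C \<Longrightarrow> subset.chain F C \<Longrightarrow> has_chain (card C) C"
proof (induction "card C" arbitrary: C)
  case 0
  then show ?case by (simp add: has_chain_def)
next
  case (Suc m)
  define B where "B = \<Union>C"
  have B: "B \<in> C" unfolding B_def using Suc by (intro Union_in_chain) auto
  have "m = card (C - {B})" using Suc B by simp
  moreover have "subset.chain F (C - {B})" using Suc.prems(2) by (auto simp: subset_chain_def)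
  ultimately have "has_chain m (C - {B})" using Suc.hyps(1)[of "C - {B}"] Suc.prems(1) by simp
  then obtain A where A: "\<forall>i\<in>{1..m}. A i \<in> C - {B}" "\<forall>i\<in>{1..<m}. A i \<subset> A (Suc i)"
    unfolding has_chain_def by blast
  moreover have "\<forall>i\<in>{1..m}. A i \<subset> B" using A(1) by (auto simp: B_def)
  ultimately have "has_chain (Suc m) C"
    unfolding has_chain_def using B
    by (intro exI[of _ "A(Suc m := B)"]) (auto simp: le_Suc_eq less_Suc_eq)
  then show ?case using Suc.hyps(2) by simp
qed

lemma has_chain_iff_height:
  assumes "finite F"
  shows "has_chain m F \<longleftrightarrow> m \<le> height F"
proof
  assume "has_chain m F"
  then show "m \<le> height F" using card_le_height[OF assms] by (metis chain_of_has_chain)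
next
  assume "m \<le> height F"
  moreover obtain C where C: "subset.chain F C" "card C = height F" using height_attained[OF assms] .
  ultimately obtain D where D: "D \<subseteq> C" "card D = m" "finite D"
    using obtain_subset_with_card_n by metis
  then have "has_chain m D"
    using has_chain_card_of_chain[OF D(3) subset_chain_subset[OF C(1)]] by blast
  moreover have "D \<subseteq> F" using D(1) C(1) by (auto simp: subset_chain_def)
  ultimately show "has_chain m F" unfolding has_chain_def by blast
qed

definition height_below :: "'a set set \<Rightarrow> 'a set \<Rightarrow> nat" where
  "height_below F T = height {A\<in>F. A \<subseteq> T}"

lemma height_below_le_height: "finite F \<Longrightarrow> height_below F T \<le> height F"
  unfolding height_below_def by (intro height_mono) auto

lemma height_below_mono: "finite F \<Longrightarrow> T \<subseteq> U \<Longrightarrow> height_below F T \<le> height_below F U"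
  unfolding height_below_def by (intro height_mono) auto

lemma height_pos:
  assumes "finite F" "A \<in> F"
  shows "1 \<le> height F"
  using card_le_height[of F "{A}"] assms by (simp add: subset_chain_def)

lemma height_below_pos: "finite F \<Longrightarrow> {} \<in> F \<Longrightarrow> 1 \<le> height_below F T"
  unfolding height_below_def by (rule height_pos[of _ "{}"]) auto

lemma height_below_less:
  assumes "finite F" "A \<in> F" "T \<subset> A"
  shows "height_below F T < height_below F A"
proof -
  let ?G = "{B\<in>F. B \<subseteq> A}"
  have fin: "finite ?G" using assms(1) by simp
  have "height_below F T \<le> height {B\<in>?G. B \<subset> A}"
    unfolding height_below_def using assms by (intro height_mono) auto
  also have "\<dots> < height (insert A ?G)" using Suc_height_le_height_insert[OF fin, of A] by linarith
  also have "insert A ?G = ?G" using assms(2) by auto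
  finally show ?thesis by (simp add: height_below_def)
qed

lemma height_below_Un_disjoint:
  assumes "\<Union>F \<inter> B = {}"
  shows "height_below F (A \<union> B) = height_below F A"
proof -
  have "{C\<in>F. C \<subseteq> A \<union> B} = {C\<in>F. C \<subseteq> A}" using assms by blast
  then show ?thesis by (simp add: height_below_def)
qed

lemma height_below_Int_Union: "\<Union>F \<subseteq> Y \<Longrightarrow> height_below F (Y \<inter> T) = height_below F T"
  by (auto simp: height_below_def intro!: arg_cong[of _ _ height])

lemma height_below_image:
  assumes "finite F" "inj e"
  shows "height_below (image e ` F) T = height_below F (e -` T)"
proof -
  have "{A\<in>image e ` F. A \<subseteq> T} = image e ` {A\<in>F. A \<subseteq> e -` T}" by auto
  moreover have "height (image e ` {A\<in>F. A \<subseteq> e -` T}) = height {A\<in>F. A \<subseteq> e -` T}"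
    using assms by (intro height_image) (auto simp: inj_image_subset_iff inj_image_eq_iff inj_on_def)
  ultimately show ?thesis by (simp add: height_below_def)
qed

section \<open>Pairwise unions\<close>

definition joins :: "'a set set \<Rightarrow> 'a set set \<Rightarrow> 'a set set" where
  "joins F G = (\<lambda>(A, B). A \<union> B) ` (F \<times> G)"

lemma joinsI: "A \<in> F \<Longrightarrow> B \<in> G \<Longrightarrow> A \<union> B \<in> joins F G"
  by (auto simp: joins_def)

lemma Union_joins: "{} \<in> F \<Longrightarrow> {} \<in> G \<Longrightarrow> \<Union>(joins F G) = \<Union>F \<union> \<Union>G"
  by (auto simp: joins_def)

lemma joins_below: "{C\<in>joins F G. C \<subseteq> T} = joins {A\<in>F. A \<subseteq> T} {B\<in>G. B \<subseteq> T}"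
  by (auto simp: joins_def)

lemma card_joins:
  assumes "\<Union>F \<inter> \<Union>G = {}"
  shows "card (joins F G) = card F * card G"
proof -
  have "inj_on (\<lambda>(A, B). A \<union> B) (F \<times> G)"
    by (rule inj_on_inverseI[of _ "\<lambda>C. (C \<inter> \<Union>F, C \<inter> \<Union>G)"]) (use assms in auto)
  then show ?thesis by (simp add: joins_def card_image card_cartesian_product)
qed

lemma height_below_joins_less:
  assumes fin: "finite F" "finite G" and disj: "\<Union>F \<inter> \<Union>G = {}"
    and D: "D \<in> joins F G" and E: "E \<in> joins F G" and "D \<subset> E"
  shows "height_below F D + height_below G D < height_below F E + height_below G E"
proof -
  obtain A B where AB: "A \<in> F" "B \<in> G" "D = A \<union> B" using D by (auto simp: joins_def)
  obtain A' B' where AB': "A' \<in> F" "B' \<in> G" "E = A' \<union> B'" using E by (auto simp: joins_def)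
  have "A \<inter> B' = {}" "A' \<inter> B = {}" using AB(1,2) AB'(1,2) disj by blast+
  then have "A \<subseteq> A'" "B \<subseteq> B'" "A \<subset> A' \<or> B \<subset> B'" using AB(3) AB'(3) \<open>D \<subset> E\<close> by blast+
  then have "height_below F A \<le> height_below F A'" "height_below G B \<le> height_below G B'"
    "height_below F A < height_below F A' \<or> height_below G B < height_below G B'"
    using fin AB' by (auto intro: height_below_mono height_below_less)
  moreover have "\<Union>F \<inter> B = {}" "\<Union>F \<inter> B' = {}" "\<Union>G \<inter> A = {}" "\<Union>G \<inter> A' = {}"
    using AB(1,2) AB'(1,2) disj by blast+
  then have "height_below F D = height_below F A" "height_below F E = height_below F A'"
    "height_below G D = height_below G B" "height_below G E = height_below G B'"
    using height_below_Un_disjoint[of F B A] height_below_Un_disjoint[of F B' A']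
      height_below_Un_disjoint[of G A B] height_below_Un_disjoint[of G A' B']
    unfolding AB(3) AB'(3) by (simp_all add: Un_commute)
  ultimately show ?thesis by linarith
qed

lemma Suc_height_joins_le:
  assumes fin: "finite F" "finite G" and "{} \<in> F" "{} \<in> G" and disj: "\<Union>F \<inter> \<Union>G = {}"
  shows "Suc (height (joins F G)) \<le> height F + height G"
proof -
  let ?g = "\<lambda>D. height_below F D + height_below G D"
  have "finite (joins F G)" using fin by (simp add: joins_def)
  then obtain C where C: "subset.chain (joins F G) C" "card C = height (joins F G)"
    by (rule height_attained)
  have "card C \<le> card {2..height F + height G}"
  proof (rule card_inj_on_le)
    show "inj_on ?g C"
      by (rule inj_on_chain_strict_mono[OF C(1)])
        (use C(1) in \<open>auto simp: subset_chain_def intro!: height_below_joins_less[OF fin disj]\<close>)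
    have "2 \<le> ?g D" "?g D \<le> height F + height G" for D
      using height_below_pos[OF fin(1), of D] height_below_pos[OF fin(2), of D] assms(3,4)
        height_below_le_height[OF fin(1), of D] height_below_le_height[OF fin(2), of D] by linarith+
    then show "?g ` C \<subseteq> {2..height F + height G}" by auto
  qed simp
  then show ?thesis using C(2) height_pos[OF fin(1) assms(3)] height_pos[OF fin(2) assms(4)] by simp
qed

lemma height_add_le_Suc_joins:
  assumes fin: "finite F" "finite G" and "{} \<in> F" "{} \<in> G" and disj: "\<Union>F \<inter> \<Union>G = {}"
  shows "height F + height G \<le> Suc (height (joins F G))"
proof -
  obtain C where C: "subset.chain F C" "finite C" "card C = height F"
    using height_attained[OF fin(1)] .
  obtain D where D: "subset.chain G D" "finite D" "card D = height G"
    using height_attained[OF fin(2)] .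
  define U where "U = \<Union>C"
  define D' where "D' = (\<union>) U ` (D - {{}})"
  have sub: "C \<subseteq> F" "D \<subseteq> G" using C(1) D(1) by (simp_all add: subset_chain_def)
  have "C \<noteq> {}" using C(3) height_pos[OF fin(1) assms(3)] by auto
  then have U: "U \<in> C" unfolding U_def using C by (intro Union_in_chain)
  have "U \<subseteq> \<Union>F" using U sub(1) by blast
  then have fresh: "B \<inter> U = {}" if "B \<in> D" for B using that sub(2) disj by blast
  have "subset.chain (joins F G) (C \<union> D')"
  proof (rule subset_chain_Un)
    have "A \<in> joins F G" if "A \<in> C" for A using that sub(1) joinsI[of A F "{}" G] assms(4) by auto
    then have "C \<subseteq> joins F G" ..
    then show "subset.chain (joins F G) C" using subset_chain_subset[OF C(1)] by simp
    have "D' \<subseteq> joins F G" unfolding D'_def using sub U joinsI[of U F _ G] by blast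
    moreover have "U \<union> A \<subseteq> U \<union> B \<or> U \<union> B \<subseteq> U \<union> A" if "A \<in> D" "B \<in> D" for A B
      using that D(1) unfolding subset_chain_def by blast
    ultimately show "subset.chain (joins F G) D'" by (auto simp: D'_def subset_chain_def)
  qed (auto simp: D'_def U_def)
  then have "card (C \<union> D') \<le> height (joins F G)"
    using fin by (intro card_le_height) (simp_all add: joins_def)
  moreover have "C \<inter> D' = {}"
  proof -
    have "U \<union> B \<notin> C" if "B \<in> D - {{}}" for B
    proof
      assume "U \<union> B \<in> C"
      then have "B \<subseteq> U" by (auto simp: U_def)
      then show False using that fresh[of B] by blast
    qed
    then show ?thesis by (auto simp: D'_def)
  qed
  moreover have "card D' = card (D - {{}})"
    unfolding D'_def by (intro card_image inj_on_inverseI[of _ "\<lambda>B. B - U"]) (use fresh in blast)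
  ultimately show ?thesis
    using C(2,3) D(2,3) by (simp add: card_Un_disjoint D'_def card_Diff_singleton_if split: if_splits)
qed

lemma height_below_joins:
  assumes "finite F" "finite G" "{} \<in> F" "{} \<in> G" "\<Union>F \<inter> \<Union>G = {}"
  shows "Suc (height_below (joins F G) T) = height_below F T + height_below G T"
proof -
  let ?F = "{A\<in>F. A \<subseteq> T}" and ?G = "{B\<in>G. B \<subseteq> T}"
  have small: "finite ?F" "finite ?G" "{} \<in> ?F" "{} \<in> ?G" "\<Union>?F \<inter> \<Union>?G = {}" using assms by auto
  have "Suc (height (joins ?F ?G)) = height ?F + height ?G"
    by (rule antisym[OF Suc_height_joins_le[OF small] height_add_le_Suc_joins[OF small]])
  then show ?thesis by (simp add: height_below_def joins_below)
qed

section \<open>Saturated systems\<close>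

lemma finite_if_subset_Pow: "finite X \<Longrightarrow> F \<subseteq> Pow X \<Longrightarrow> finite F"
  by (meson finite_Pow_iff finite_subset)

lemma saturated_iff_height:
  assumes "finite X"
  shows "saturated_Sperner_system k X F \<longleftrightarrow>
    F \<subseteq> Pow X \<and> height F \<le> k \<and> (\<forall>Z\<in>Pow X - F. k < height (insert Z F))"
proof -
  have "F \<subseteq> Pow X \<Longrightarrow> finite F" using finite_if_subset_Pow[OF assms] .
  then show ?thesis
    unfolding saturated_Sperner_system_def Sperner_system_def
    by (auto simp: has_chain_iff_height not_le Suc_le_eq)
qed

lemma saturatedD:
  assumes "finite X" "saturated_Sperner_system k X F"
  shows "F \<subseteq> Pow X" "finite F" "height F \<le> k"
    "Z \<subseteq> X \<Longrightarrow> Z \<notin> F \<Longrightarrow> k < height (insert Z F)"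
  using assms finite_if_subset_Pow[OF assms(1)] by (auto simp: saturated_iff_height)

lemma saturated_height_split:
  assumes "finite X" "saturated_Sperner_system k X F" "Z \<subseteq> X" "Z \<notin> F"
  shows "height {A\<in>F. A \<subset> Z} + height {A\<in>F. Z \<subset> A} = k"
proof -
  note F = saturatedD[OF assms(1,2)]
  show ?thesis
    using F(3) F(4)[OF assms(3,4)] height_insert[OF F(2), of Z] height_insert_le_Suc[OF F(2), of Z]
    by linarith
qed

lemma saturated_compl:
  assumes "finite X" "saturated_Sperner_system k X F"
  shows "saturated_Sperner_system k X ((-) X ` F)"
proof -
  note F = saturatedD[OF assms]
  have "k < height (insert Z ((-) X ` F))" if Z: "Z \<in> Pow X - (-) X ` F" for Z
  proof -
    have Z_eq: "X - (X - Z) = Z" using Z by blast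
    then have "X - Z \<notin> F" using Z by (metis DiffD2 image_eqI)
    then have "k < height ((-) X ` insert (X - Z) F)" using F by (subst height_compl) auto
    then show ?thesis by (simp add: Z_eq)
  qed
  then show ?thesis using F assms(1) by (auto simp: saturated_iff_height height_compl)
qed

text \<open>
  In a saturated \<open>k\<close>-Sperner system the bottoms of the chains of length \<open>k\<close> form an antichain,
  which can be traded for the empty set.
\<close>

definition chain_bottoms :: "nat \<Rightarrow> 'a set set \<Rightarrow> 'a set set" where
  "chain_bottoms k F = {\<Inter>C | C. subset.chain F C \<and> finite C \<and> card C = k}"

lemma chain_bottoms_subset:
  assumes "1 \<le> k"
  shows "chain_bottoms k F \<subseteq> F"
proof
  fix A assume "A \<in> chain_bottoms k F"
  then obtain C where C: "subset.chain F C" "finite C" "card C = k" "A = \<Inter>C"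
    by (auto simp: chain_bottoms_def)
  then have "A \<in> C" using assms by (auto intro: Inter_in_chain)
  then show "A \<in> F" using C(1) by (auto simp: subset_chain_def)
qed

lemma chain_bottoms_minimal:
  assumes "finite F" "height F \<le> k" "A \<in> F" "B \<in> chain_bottoms k F"
  shows "\<not> A \<subset> B"
proof
  assume "A \<subset> B"
  obtain C where C: "subset.chain F C" "finite C" "card C = k" "B = \<Inter>C"
    using assms(4) by (auto simp: chain_bottoms_def)
  have "subset.chain F (insert A C)"
    using C(1,4) \<open>A \<in> F\<close> \<open>A \<subset> B\<close> by (auto simp: subset_chain_insert)
  then have "card (insert A C) \<le> height F" by (rule card_le_height[OF assms(1)])
  moreover have "A \<notin> C" using C(4) \<open>A \<subset> B\<close> by auto
  ultimately show False using C(2,3) assms(2) by simp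
qed

lemma card_chain_Int_antichain_le:
  assumes "subset.chain F C" "finite C" "\<And>A B. A \<in> Q \<Longrightarrow> B \<in> Q \<Longrightarrow> \<not> A \<subset> B"
  shows "card (C \<inter> Q) \<le> 1"
proof -
  have "A = B" if "A \<in> C \<inter> Q" "B \<in> C \<inter> Q" for A B
  proof -
    have "A \<subseteq> B \<or> B \<subseteq> A" using that assms(1) by (simp add: subset_chain_def)
    then show ?thesis using that assms(3)[of A B] assms(3)[of B A] by blast
  qed
  then show ?thesis using assms(2) by (simp add: card_le_Suc0_iff_eq)
qed

lemma chain_through_avoiding_bottoms:
  assumes "finite F" "height F \<le> k" "1 \<le> k"
    and Z: "Z \<in> chain_bottoms k F \<or> Z \<notin> F \<and> k < height (insert Z F)"
  obtains C where "subset.chain (insert Z F) C" "finite C" "Z \<in> C"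
    "k \<le> Suc (card (C - {Z} - chain_bottoms k F))"
proof -
  let ?Q = "chain_bottoms k F"
  have Q: "?Q \<subseteq> F" using assms(3) by (rule chain_bottoms_subset)
  note minimal = chain_bottoms_minimal[OF assms(1,2)]
  show thesis
  proof (cases "Z \<in> ?Q")
    case True
    then obtain C where C: "subset.chain F C" "finite C" "card C = k" "Z = \<Inter>C"
      by (auto simp: chain_bottoms_def)
    then have "Z \<in> C" using assms(3) by (auto intro: Inter_in_chain)
    moreover have "C - {Z} - ?Q = C - {Z}" using minimal[of Z] True Q C(4) by blast
    moreover have "subset.chain (insert Z F) C" using C(1) by (rule subset_chain_mono) blast
    ultimately show thesis using C(2,3) that by simp
  next
    case False
    then have "Z \<notin> F" "k < height (insert Z F)" using Z by auto
    obtain C where C: "subset.chain (insert Z F) C" "finite C" "card C = height (insert Z F)"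
      using height_attained[of "insert Z F"] assms(1) by auto
    have chain: "subset.chain F (C - {Z})" using C(1) by (auto simp: subset_chain_def)
    then have "card (C - {Z}) \<le> k" using card_le_height[OF assms(1)] assms(2) by fastforce
    then have "Z \<in> C" using C(3) \<open>k < height (insert Z F)\<close> by (cases "Z \<in> C") auto
    have "card ((C - {Z}) \<inter> ?Q) \<le> 1"
      using minimal Q C(2) by (intro card_chain_Int_antichain_le[OF chain]) auto
    moreover have "card (C - {Z} - ?Q) = card (C - {Z}) - card ((C - {Z}) \<inter> ?Q)"
      using C(2) by (simp add: card_Diff_subset_Int)
    ultimately have "k \<le> Suc (card (C - {Z} - ?Q))"
      using C(2,3) \<open>k < height (insert Z F)\<close> \<open>Z \<in> C\<close> by simp
    then show thesis using that C(1,2) \<open>Z \<in> C\<close> by blast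
  qed
qed

lemma height_exchange_bottoms_le:
  assumes "finite F" "1 \<le> k"
  shows "height (insert {} (F - chain_bottoms k F)) \<le> k"
proof (rule ccontr)
  let ?F' = "F - chain_bottoms k F"
  obtain C where C: "subset.chain (insert {} ?F') C" "finite C" "card C = height (insert {} ?F')"
    using height_attained[of "insert {} ?F'"] assms(1) by auto
  assume "\<not> height (insert {} ?F') \<le> k"
  then have "k < card C" using C(3) by simp
  then have "k \<le> card (C - {{}})" using C(2) by (auto simp: card_Diff_singleton_if)
  then obtain D where D: "D \<subseteq> C - {{}}" "card D = k" "finite D" by (rule obtain_subset_with_card_n)
  have chain: "subset.chain ?F' D"
    by (rule subset_chain_subset[OF C(1)]) (use C(1) D(1) in \<open>auto simp: subset_chain_def\<close>)
  then have "\<Inter>D \<in> chain_bottoms k F"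
    using D(2,3) subset_chain_mono[OF chain Diff_subset] unfolding chain_bottoms_def by blast
  moreover have "\<Inter>D \<in> D" using D(2,3) assms(2) chain by (intro Inter_in_chain) auto
  ultimately show False using chain by (auto simp: subset_chain_def)
qed

lemma saturated_exchange_bottoms:
  assumes "finite X" "saturated_Sperner_system k X F" "{} \<notin> F" "1 \<le> k"
  shows "saturated_Sperner_system k X (insert {} (F - chain_bottoms k F))"
proof -
  let ?F' = "insert {} (F - chain_bottoms k F)"
  note F = saturatedD[OF assms(1,2)]
  have "k < height (insert Z ?F')" if Z: "Z \<in> Pow X - ?F'" for Z
  proof -
    obtain C where C: "subset.chain (insert Z F) C" "finite C" "Z \<in> C"
      "k \<le> Suc (card (C - {Z} - chain_bottoms k F))"
      using chain_through_avoiding_bottoms[OF F(2,3) assms(4), of Z] F(4)[of Z] Z by blast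
    define E where "E = C - {Z} - chain_bottoms k F"
    have "E \<subseteq> F - chain_bottoms k F" using C(1) by (auto simp: E_def subset_chain_def)
    then have "subset.chain (insert Z ?F') (insert {} (insert Z E))"
      using C(1,3) by (auto simp: E_def subset_chain_insert subset_chain_def)
    then have "card (insert {} (insert Z E)) \<le> height (insert Z ?F')"
      using F(2) by (intro card_le_height) auto
    moreover have "Z \<notin> E" "{} \<notin> insert Z E" using Z assms(3) \<open>E \<subseteq> _\<close> by (auto simp: E_def)
    moreover have "finite E" "k \<le> Suc (card E)" using C(2,4) by (simp_all add: E_def)
    ultimately show ?thesis by simp
  qed
  then show ?thesis
    using F assms(1) height_exchange_bottoms_le[OF F(2) assms(4)]
    by (auto simp: saturated_iff_height)
qed

lemma card_exchange_bottoms_le: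
  assumes "finite X" "saturated_Sperner_system k X F" "{} \<notin> F" "1 \<le> k"
  shows "card (insert {} (F - chain_bottoms k F)) \<le> card F"
proof -
  note F = saturatedD[OF assms(1,2)]
  have "{A \<in> F. {} \<subset> A} = F" "{A \<in> F. A \<subset> {}} = {}" using assms(3) by auto
  then have "height F = k"
    using F(3) F(4)[of "{}"] assms(3) height_insert_le[OF F(2), of "{}"] by simp
  then obtain C where "subset.chain F C" "finite C" "card C = k"
    using height_attained[OF F(2)] by metis
  then have bottom: "\<Inter>C \<in> chain_bottoms k F" by (auto simp: chain_bottoms_def)
  then have "\<Inter>C \<in> F" using chain_bottoms_subset[OF assms(4)] by blast
  then have "card (F - chain_bottoms k F) < card F"
    using F(2) bottom by (intro psubset_card_mono) auto
  then show ?thesis using F(2) by (simp add: card_insert_if)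
qed

lemma saturated_with_empty:
  assumes "finite X" "saturated_Sperner_system k X F" "2 \<le> k"
  obtains F' where "saturated_Sperner_system k X F'" "{} \<in> F'" "card F' \<le> card F" "X \<in> F \<Longrightarrow> X \<in> F'"
proof (cases "{} \<in> F")
  case True
  then show thesis using that assms(2) by blast
next
  case False
  note F = saturatedD(1)[OF assms(1,2)]
  have "X \<notin> chain_bottoms k F"
  proof
    assume "X \<in> chain_bottoms k F"
    then obtain C where C: "subset.chain F C" "card C = k" "X = \<Inter>C" by (auto simp: chain_bottoms_def)
    then have "C \<subseteq> {X}" using F by (auto simp: subset_chain_def)
    then have "card C \<le> 1" using card_mono[of "{X}"] by fastforce
    then show False using C(2) assms(3) by simp
  qed
  then show thesis
    using that[OF saturated_exchange_bottoms[OF assms(1,2) False]]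
      card_exchange_bottoms_le[OF assms(1,2) False] assms(3) by auto
qed

lemma saturated_with_empty_and_full:
  assumes "finite X" "saturated_Sperner_system k X F" "2 \<le> k"
  obtains F' where "saturated_Sperner_system k X F'" "{} \<in> F'" "X \<in> F'" "card F' \<le> card F"
proof -
  obtain G where G: "saturated_Sperner_system k X G" "{} \<in> G" "card G \<le> card F"
    using saturated_with_empty[OF assms] by metis
  have "finite G" using saturatedD(2)[OF assms(1) G(1)] .
  have "X \<in> (-) X ` G" using G(2) by force
  then obtain F' where F': "saturated_Sperner_system k X F'" "{} \<in> F'" "X \<in> F'"
    "card F' \<le> card ((-) X ` G)"
    using saturated_with_empty[OF assms(1) saturated_compl[OF assms(1) G(1)] assms(3)] by metis
  have "card F' \<le> card F" using F'(4) G(3) card_image_le[OF \<open>finite G\<close>, of "(-) X"] by linarith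
  then show thesis using that F' by blast
qed

section \<open>Complementary pairs\<close>

text \<open>
  The large members are recorded by their complements, so that the conditions on \<open>S\<close> and \<open>M\<close>
  are alike and only chains below a set occur.
\<close>

locale complementary_pair =
  fixes k :: nat and S M :: "'a set set"
  assumes finite_grounds: "finite (\<Union>S)" "finite (\<Union>M)"
    and empty_mem: "{} \<in> S" "{} \<in> M"
    and heights: "height_below S T + height_below M (- T) = k"
begin

lemma finite_members: "finite S" "finite M"
  using finite_grounds by (simp_all add: finite_UnionD)

lemma height_compl_above:
  assumes "M \<subseteq> Pow X"
  shows "height ((-) X ` {B\<in>M. B \<subseteq> - T}) = height_below M (- T)"
  unfolding height_below_def using finite_members assms by (intro height_compl) auto

lemma height_Un_compl_le:
  assumes "\<Union>S \<union> \<Union>M \<subset> X"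
  shows "height (S \<union> (-) X ` M) \<le> k"
proof -
  let ?F = "S \<union> (-) X ` M"
  obtain p where p: "p \<in> X" "p \<notin> \<Union>S" "p \<notin> \<Union>M" using assms by blast
  have "finite ?F" using finite_members by simp
  then obtain C where C: "subset.chain ?F C" "finite C" "card C = height ?F" by (rule height_attained)
  define T where "T = \<Union>(C \<inter> S)"
  have "card (C \<inter> S) \<le> height_below S T"
    unfolding height_below_def using finite_members
    by (intro card_le_height subset_chain_subset[OF C(1)]) (auto simp: T_def)
  moreover have "card (C - S) \<le> height ((-) X ` {B\<in>M. B \<subseteq> - T})"
  proof (intro card_le_height subset_chain_subset[OF C(1)] subsetI)
    fix E assume E: "E \<in> C - S"
    then obtain B where B: "B \<in> M" "E = X - B" using C(1) by (auto simp: subset_chain_def)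
    have "A \<subseteq> E" if "A \<in> C \<inter> S" for A
    proof -
      have "A \<subseteq> E \<or> E \<subseteq> A" using C(1) that E by (auto simp: subset_chain_def)
      moreover have "p \<in> E" "p \<notin> A" using p B that by auto
      ultimately show ?thesis by blast
    qed
    then have "B \<subseteq> - T" using B(2) by (auto simp: T_def)
    then show "E \<in> (-) X ` {B\<in>M. B \<subseteq> - T}" using B by blast
  qed (use finite_members in auto)
  moreover have "M \<subseteq> Pow X" using assms by auto
  moreover have "card C = card (C \<inter> S) + card (C - S)" using C(2) by (simp add: card_Int_Diff)
  ultimately show ?thesis using C(3) height_compl_above[of X T] heights[of T] by simp
qed

lemma less_height_insert_Un_compl:
  assumes "M \<subseteq> Pow X" "Z \<subseteq> X" "Z \<notin> S \<union> (-) X ` M"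
  shows "k < height (insert Z (S \<union> (-) X ` M))"
proof -
  let ?F = "S \<union> (-) X ` M"
  have fin: "finite ?F" using finite_members by simp
  have "height_below S Z \<le> height {A\<in>?F. A \<subset> Z}"
    unfolding height_below_def using assms fin by (intro height_mono) auto
  moreover have "height ((-) X ` {B\<in>M. B \<subseteq> - Z}) \<le> height {A\<in>?F. Z \<subset> A}"
    using assms fin by (intro height_mono) auto
  ultimately show ?thesis
    using Suc_height_le_height_insert[OF fin, of Z] height_compl_above[OF assms(1), of Z] heights[of Z]
    by linarith
qed

lemma saturated_Un_compl:
  assumes "finite X" "\<Union>S \<union> \<Union>M \<subset> X"
  shows "saturated_Sperner_system k X (S \<union> (-) X ` M)"
proof -
  have "S \<subseteq> Pow X" "M \<subseteq> Pow X" using assms(2) by auto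
  then show ?thesis
    using height_Un_compl_le[OF assms(2)] less_height_insert_Un_compl assms(1)
    by (auto simp: saturated_iff_height)
qed

lemma card_Un_compl:
  assumes "\<Union>S \<union> \<Union>M \<subset> X"
  shows "card (S \<union> (-) X ` M) = card S + card M"
proof -
  have "inj_on ((-) X) M" using assms by (intro inj_on_compl) auto
  moreover have "S \<inter> (-) X ` M = {}" using assms by blast
  ultimately show ?thesis using finite_members by (simp add: card_Un_disjoint card_image)
qed

end

lemma complementary_pair_of_saturated:
  assumes "finite X" and sat: "saturated_Sperner_system k X F" and mem: "{} \<in> F" "X \<in> F"
    and xy: "x \<in> X" "y \<in> X" "x \<noteq> y" and twins: "\<And>A. A \<in> F \<Longrightarrow> x \<in> A \<longleftrightarrow> y \<in> A"
  shows "complementary_pair k {A\<in>F. x \<notin> A} ((-) X ` {A\<in>F. x \<in> A})"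
proof
  note F = saturatedD[OF assms(1) sat]
  show "finite (\<Union>{A\<in>F. x \<notin> A})" "finite (\<Union>((-) X ` {A\<in>F. x \<in> A}))"
    using F(1) by (auto intro: finite_subset[OF _ assms(1)])
  show "{} \<in> {A\<in>F. x \<notin> A}" "{} \<in> (-) X ` {A\<in>F. x \<in> A}" using mem xy by force+
  fix T
  define Z where "Z = insert x (T \<inter> X - {y})"
  have Z: "Z \<subseteq> X" "Z \<notin> F" using xy twins[of Z] by (auto simp: Z_def)
  have "height {A\<in>F. A \<subset> Z} + height {A\<in>F. Z \<subset> A} = k"
    using saturated_height_split[OF assms(1) sat Z] .
  moreover have "{A\<in>F. A \<subset> Z} = {A \<in> {A\<in>F. x \<notin> A}. A \<subseteq> T}"
    using F(1) xy(3) twins Z(2) by (auto simp: Z_def)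
  moreover have "(-) X ` {A\<in>F. Z \<subset> A} = {B \<in> (-) X ` {A\<in>F. x \<in> A}. B \<subseteq> - T}"
    using F(1) xy twins Z(2) by (auto simp: Z_def)
  moreover have "height ((-) X ` {A\<in>F. Z \<subset> A}) = height {A\<in>F. Z \<subset> A}"
    using F by (intro height_compl) auto
  ultimately show "height_below {A\<in>F. x \<notin> A} T + height_below ((-) X ` {A\<in>F. x \<in> A}) (- T) = k"
    unfolding height_below_def by argo
qed

lemma ex_twins:
  assumes "finite X" "finite F" "2 ^ card F < card X"
  obtains x y where "x \<in> X" "y \<in> X" "x \<noteq> y" "\<And>A. A \<in> F \<Longrightarrow> x \<in> A \<longleftrightarrow> y \<in> A"
proof -
  let ?members = "\<lambda>x. {A\<in>F. x \<in> A}"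
  have "card (?members ` X) \<le> card (Pow F)" using assms(2) by (intro card_mono) auto
  then have "\<not> inj_on ?members X" using assms(2,3) by (auto simp: card_image card_Pow)
  then obtain x y where "x \<in> X" "y \<in> X" "x \<noteq> y" "?members x = ?members y"
    unfolding inj_on_def by blast
  then show thesis using that[of x y] by blast
qed

lemma complementary_pair_Pow:
  assumes "finite Y"
  shows "complementary_pair (card Y + 2) (Pow Y) (Pow Y)"
proof
  fix T
  have "height_below (Pow Y) U = Suc (card (Y \<inter> U))" for U
  proof -
    have "{A \<in> Pow Y. A \<subseteq> U} = Pow (Y \<inter> U)" by auto
    then show ?thesis
      using height_Pow[of "Y \<inter> U"] assms by (simp only: height_below_def finite_Int simp_thms)
  qed
  then show "height_below (Pow Y) T + height_below (Pow Y) (- T) = card Y + 2"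
    using card_Int_Diff[OF assms, of T] by (simp add: Diff_eq)
qed (use assms in auto)

lemma complementary_pair_image:
  assumes "complementary_pair k S M" "inj e"
  shows "complementary_pair k (image e ` S) (image e ` M)"
proof -
  interpret complementary_pair k S M by fact
  show ?thesis
  proof
    show "finite (\<Union>(image e ` S))" "finite (\<Union>(image e ` M))"
      using finite_grounds by (simp_all flip: image_Union)
    show "{} \<in> image e ` S" "{} \<in> image e ` M" using empty_mem by auto
    fix T
    show "height_below (image e ` S) T + height_below (image e ` M) (- T) = k"
      using heights[of "e -` T"] finite_members
      by (simp add: height_below_image[OF _ assms(2)] vimage_Compl)
  qed
qed

lemma complementary_pair_joins:
  assumes "complementary_pair k S M" "complementary_pair l S' M'"
    and disjoint: "\<Union>S \<inter> \<Union>S' = {}" "\<Union>M \<inter> \<Union>M' = {}"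
  shows "complementary_pair (k + l - 2) (joins S S') (joins M M')"
proof -
  interpret p: complementary_pair k S M by fact
  interpret q: complementary_pair l S' M' by fact
  show ?thesis
  proof
    show "finite (\<Union>(joins S S'))" "finite (\<Union>(joins M M'))"
      using p.finite_grounds q.finite_grounds by (simp_all add: Union_joins p.empty_mem q.empty_mem)
    show "{} \<in> joins S S'" "{} \<in> joins M M'"
      using joinsI[OF p.empty_mem(1) q.empty_mem(1)] joinsI[OF p.empty_mem(2) q.empty_mem(2)]
      by simp_all
    fix T
    have "Suc (height_below (joins S S') T) = height_below S T + height_below S' T"
      by (rule height_below_joins)
        (use p.finite_members q.finite_members p.empty_mem q.empty_mem disjoint in simp_all)
    moreover have "Suc (height_below (joins M M') (- T)) = height_below M (- T) + height_below M' (- T)"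
      by (rule height_below_joins)
        (use p.finite_members q.finite_members p.empty_mem q.empty_mem disjoint in simp_all)
    ultimately show "height_below (joins S S') T + height_below (joins M M') (- T) = k + l - 2"
      using p.heights[of T] q.heights[of T] by linarith
  qed
qed

section \<open>The lower bound\<close>

lemma card_subcube_mult_le:
  fixes A B :: "'a set"
  assumes "finite Y" "A \<subseteq> Y" "B \<subseteq> Y"
  shows "card {A..Y - B} * 2 ^ (card A + card B) \<le> 2 ^ card Y"
proof (cases "A \<inter> B = {}")
  case True
  define R where "R = Y - (A \<union> B)"
  have "{A..Y - B} \<subseteq> (\<union>) A ` Pow R"
  proof
    fix T assume "T \<in> {A..Y - B}"
    then have "T = A \<union> (T - A)" "T - A \<in> Pow R" by (auto simp: R_def)
    then show "T \<in> (\<union>) A ` Pow R" by blast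
  qed
  then have "card {A..Y - B} \<le> card (Pow R)"
    by (rule surj_card_le[rotated]) (simp add: R_def assms(1))
  also have "\<dots> = 2 ^ card R" using assms(1) by (simp add: R_def card_Pow)
  finally have "card {A..Y - B} * 2 ^ (card A + card B) \<le> 2 ^ (card R + (card A + card B))"
    by (simp add: power_add)
  also have "card R + (card A + card B) = card Y"
  proof -
    have sub: "A \<union> B \<subseteq> Y" and fin: "finite A" "finite B" using assms finite_subset by auto
    have "card (A \<union> B) \<le> card Y" by (rule card_mono[OF assms(1) sub])
    moreover have "card R = card Y - card (A \<union> B)" using fin sub by (simp add: R_def card_Diff_subset)
    ultimately show ?thesis using card_Un_disjoint[OF fin True] by simp
  qed
  finally show ?thesis .
next
  case False
  then have "{A..Y - B} = {}" by auto
  then show ?thesis by simp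
qed

lemma power_le_card_if_subcubes_cover:
  assumes fin: "finite Y" "finite P"
    and codim: "\<And>A B. (A, B) \<in> P \<Longrightarrow> A \<subseteq> Y \<and> B \<subseteq> Y \<and> d \<le> card A + card B"
    and cover: "\<And>T. T \<subseteq> Y \<Longrightarrow> \<exists>(A, B)\<in>P. A \<subseteq> T \<and> B \<subseteq> - T"
  shows "2 ^ d \<le> card P"
proof -
  have "Pow Y \<subseteq> (\<Union>(A, B)\<in>P. {A..Y - B})"
  proof
    fix T assume "T \<in> Pow Y"
    then obtain A B where "(A, B) \<in> P" "A \<subseteq> T" "T \<subseteq> Y - B" using cover[of T] by blast
    then show "T \<in> (\<Union>(A, B)\<in>P. {A..Y - B})" by (intro UN_I[of "(A, B)"]) auto
  qed
  moreover have "finite {A..Y - B}" for A B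
    using fin(1) by (intro finite_subset[of "{A..Y - B}" "Pow Y"]) auto
  ultimately have "2 ^ card Y \<le> card (\<Union>(A, B)\<in>P. {A..Y - B})"
    using fin by (subst card_Pow[symmetric]) (auto intro!: card_mono)
  also have "\<dots> \<le> (\<Sum>(A, B)\<in>P. card {A..Y - B})"
    using card_UN_le[OF fin(2)] by (simp add: case_prod_unfold)
  finally have "2 ^ card Y * 2 ^ d \<le> (\<Sum>(A, B)\<in>P. card {A..Y - B} * 2 ^ d)"
    by (simp add: case_prod_unfold flip: sum_distrib_right)
  also have "\<dots> \<le> (\<Sum>(A, B)\<in>P. 2 ^ card Y)"
  proof (intro sum_mono, clarify)
    fix A B assume "(A, B) \<in> P"
    then have AB: "A \<subseteq> Y" "B \<subseteq> Y" "d \<le> card A + card B" using codim by auto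
    have "card {A..Y - B} * 2 ^ d \<le> card {A..Y - B} * 2 ^ (card A + card B)"
      using AB(3) by (intro mult_le_mono2 power_increasing) auto
    also have "\<dots> \<le> 2 ^ card Y" by (rule card_subcube_mult_le[OF fin(1) AB(1,2)])
    finally show "card {A..Y - B} * 2 ^ d \<le> 2 ^ card Y" .
  qed
  finally show ?thesis by (simp add: case_prod_unfold)
qed

lemma height_below_le_Suc_card:
  assumes "finite F" "finite (\<Union>F)" "{} \<in> F"
  obtains A where "A \<in> F" "A \<subseteq> T" "height_below F T \<le> Suc (card A)"
proof -
  have "finite {A\<in>F. A \<subseteq> T}" using assms(1) by simp
  then obtain C where C: "subset.chain {A\<in>F. A \<subseteq> T} C" "finite C" "card C = height_below F T"
    unfolding height_below_def by (rule height_attained)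
  have "C \<noteq> {}" using C(3) height_below_pos[OF assms(1,3), of T] by auto
  then have "\<Union>C \<in> C" using C by (intro Union_in_chain)
  then have top: "\<Union>C \<in> F" "\<Union>C \<subseteq> T" using C(1) by (auto simp: subset_chain_def)
  then have "finite (\<Union>C)" using assms(2) by (meson Union_upper finite_subset)
  moreover have "subset.chain (Pow (\<Union>C)) C" by (rule subset_chain_subset[OF C(1)]) auto
  ultimately have "card C \<le> Suc (card (\<Union>C))"
    using card_le_height[of "Pow (\<Union>C)" C] by (simp add: height_Pow)
  then show thesis using that[OF top] C(3) by simp
qed

lemma (in complementary_pair) power_le_card_mult: "2 ^ (k - 2) \<le> card S * card M"
proof -
  define P where "P = {(A, B) \<in> S \<times> M. k - 2 \<le> card A + card B}"
  have P: "P \<subseteq> S \<times> M" "finite (S \<times> M)" using finite_members by (auto simp: P_def)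
  have "2 ^ (k - 2) \<le> card P"
  proof (rule power_le_card_if_subcubes_cover)
    show "finite (\<Union>S \<union> \<Union>M)" using finite_grounds by simp
    show "finite P" using P finite_subset by blast
    show "A \<subseteq> \<Union>S \<union> \<Union>M \<and> B \<subseteq> \<Union>S \<union> \<Union>M \<and> k - 2 \<le> card A + card B"
      if "(A, B) \<in> P" for A B
      using that by (auto simp: P_def)
    fix T
    obtain A where A: "A \<in> S" "A \<subseteq> T" "height_below S T \<le> Suc (card A)"
      using height_below_le_Suc_card finite_members(1) finite_grounds(1) empty_mem(1) .
    obtain B where B: "B \<in> M" "B \<subseteq> - T" "height_below M (- T) \<le> Suc (card B)"
      using height_below_le_Suc_card finite_members(2) finite_grounds(2) empty_mem(2) .
    have "(A, B) \<in> P" using A B heights[of T] by (auto simp: P_def)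
    then show "\<exists>(A, B)\<in>P. A \<subseteq> T \<and> B \<subseteq> - T" using A(2) B(2) by blast
  qed
  also have "\<dots> \<le> card (S \<times> M)" by (rule card_mono[OF P(2,1)])
  finally show ?thesis by (simp add: card_cartesian_product)
qed

section \<open>A pair with 15 members on each side\<close>

function list_height :: "'a set list \<Rightarrow> nat" where
  "list_height [] = 0"
| "list_height (A # Fs) = max (list_height Fs) (Suc (list_height (filter (\<lambda>B. B \<subset> A) Fs)))"
  by pat_completeness auto
termination by (relation "measure length") (auto simp: less_Suc_eq_le)

lemma height_set:
  "sorted_wrt (\<lambda>A B. \<not> A \<subset> B) Fs \<Longrightarrow> height (set Fs) = list_height Fs"
proof (induction Fs rule: list_height.induct)
  case (2 A Fs)
  have above: "{B \<in> set Fs. A \<subset> B} = {}" using "2.prems" by auto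
  have "height (set (A # Fs)) = max (height (set Fs)) (Suc (height {B \<in> set Fs. B \<subset> A}))"
    by (simp only: list.set(2) height_insert[OF finite_set] above height_empty add_0_right)
  also have "{B \<in> set Fs. B \<subset> A} = set (filter (\<lambda>B. B \<subset> A) Fs)" by simp
  finally show ?case using 2 by (simp add: sorted_wrt_filter del: set_filter)
qed simp

lemma height_below_set:
  assumes "sorted_wrt (\<lambda>A B. \<not> A \<subset> B) Fs"
  shows "height_below (set Fs) T = list_height (filter (\<lambda>A. A \<subseteq> T) Fs)"
  using height_set[of "filter (\<lambda>A. A \<subseteq> T) Fs"] sorted_wrt_filter[OF assms]
  by (simp add: height_below_def)

text \<open>Found by a SAT solver.\<close>

definition six_point_small :: "nat set list" where
  "six_point_small = map set
    [[0,1,2,4],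
     [0,1,2], [1,2,3], [0,4,5], [3,4,5],
     [1,2], [0,4], [3,4], [0,5], [3,5],
     [0], [1], [3], [5],
     []]"

definition six_point_mirror :: "nat set list" where
  "six_point_mirror = map (image (\<lambda>i. if even i then i + 1 else i - 1)) six_point_small"

lemma six_point_sorted:
  "sorted_wrt (\<lambda>A B. \<not> A \<subset> B) six_point_small" "sorted_wrt (\<lambda>A B. \<not> A \<subset> B) six_point_mirror"
  by code_simp+

lemma Union_six_point: "\<Union>(set six_point_small) = {..<6}" "\<Union>(set six_point_mirror) = {..<6}"
  by code_simp+

lemma card_six_point: "card (set six_point_small) = 15" "card (set six_point_mirror) = 15"
  by code_simp+

lemma list_height_six_point:
  "\<forall>T\<in>Pow {..<6}. list_height (filter (\<lambda>A. A \<subseteq> T) six_point_small)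
     + list_height (filter (\<lambda>A. A \<subseteq> {..<6} - T) six_point_mirror) = 6"
  by code_simp

lemma complementary_pair_six_point:
  "complementary_pair 6 (set six_point_small) (set six_point_mirror)"
proof
  show "finite (\<Union>(set six_point_small))" "finite (\<Union>(set six_point_mirror))"
    by (simp_all add: Union_six_point)
  show "{} \<in> set six_point_small" "{} \<in> set six_point_mirror"
    by (auto simp: six_point_small_def six_point_mirror_def)
  fix T
  have "{..<6::nat} - {..<6} \<inter> T = {..<6} \<inter> - T" by blast
  then have "height_below (set six_point_small) ({..<6} \<inter> T)
      + height_below (set six_point_mirror) ({..<6} \<inter> - T) = 6"
    using list_height_six_point[rule_format, of "{..<6} \<inter> T"]
    by (simp only: height_below_set six_point_sorted Pow_iff Int_lower1 simp_thms)
  then show "height_below (set six_point_small) T + height_below (set six_point_mirror) (- T) = 6"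
    by (simp add: height_below_Int_Union Union_six_point)
qed

section \<open>The limit of the saturation numbers\<close>

definition pair_sizes :: "nat \<Rightarrow> (nat \<times> nat) set" where
  "pair_sizes k = {(card S, card M) | S M :: nat set set. complementary_pair k S M}"

definition pair_sat :: "nat \<Rightarrow> nat" where
  "pair_sat k = (LEAST t. \<exists>(s, m)\<in>pair_sizes k. t = s + m)"

lemma pair_sizesI: "complementary_pair k (S :: nat set set) M \<Longrightarrow> (card S, card M) \<in> pair_sizes k"
  by (auto simp: pair_sizes_def)

lemma pair_sat_le: "(s, m) \<in> pair_sizes k \<Longrightarrow> pair_sat k \<le> s + m"
  unfolding pair_sat_def by (rule Least_le) auto

lemma power_mem_pair_sizes:
  assumes "2 \<le> k"
  shows "(2 ^ (k - 2), 2 ^ (k - 2)) \<in> pair_sizes k"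
proof -
  have "complementary_pair k (Pow {..<k - 2}) (Pow {..<k - 2})"
    using complementary_pair_Pow[of "{..<k - 2}"] assms
    by (metis card_lessThan finite_lessThan le_add_diff_inverse2)
  from pair_sizesI[OF this] show ?thesis by (simp add: card_Pow)
qed

lemma pair_sat_attained:
  assumes "2 \<le> k"
  obtains s m where "(s, m) \<in> pair_sizes k" "pair_sat k = s + m"
proof -
  have "\<exists>t. \<exists>(s, m)\<in>pair_sizes k. t = s + m" using power_mem_pair_sizes[OF assms] by blast
  then have "\<exists>(s, m)\<in>pair_sizes k. pair_sat k = s + m" unfolding pair_sat_def by (rule LeastI_ex)
  then show thesis using that by blast
qed

lemma pair_sat_less_power:
  assumes "2 \<le> k"
  shows "pair_sat k < 2 ^ k"
proof -
  have "pair_sat k \<le> 2 * 2 ^ (k - 2)" using pair_sat_le[OF power_mem_pair_sizes[OF assms]] by simp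
  also have "\<dots> < 2\<^sup>2 * 2 ^ (k - 2)" by simp
  also have "\<dots> = 2 ^ k" using assms by (metis le_add_diff_inverse power_add)
  finally show ?thesis .
qed

lemma pair_sizes_mult:
  assumes "(s, m) \<in> pair_sizes k" "(s', m') \<in> pair_sizes l"
  shows "(s * s', m * m') \<in> pair_sizes (k + l - 2)"
proof -
  obtain S M :: "nat set set" where SM: "complementary_pair k S M" "s = card S" "m = card M"
    using assms(1) by (auto simp: pair_sizes_def)
  obtain S' M' :: "nat set set" where SM': "complementary_pair l S' M'" "s' = card S'" "m' = card M'"
    using assms(2) by (auto simp: pair_sizes_def)
  define f g :: "nat \<Rightarrow> nat" where "f = (\<lambda>n. 2 * n)" and "g = (\<lambda>n. Suc (2 * n))"
  have inj: "inj f" "inj g" by (auto simp: f_def g_def inj_def)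
  have disjoint: "\<Union>(image f ` A) \<inter> \<Union>(image g ` B) = {}" for A B
    by (auto simp: f_def g_def; presburger)
  have card_images: "card (image h ` A) = card A" if "inj h" for h :: "nat \<Rightarrow> nat" and A
    by (intro card_image inj_onI) (simp add: inj_image_eq_iff that)
  have "complementary_pair (k + l - 2) (joins (image f ` S) (image g ` S'))
      (joins (image f ` M) (image g ` M'))"
    using SM(1) SM'(1) inj by (intro complementary_pair_joins complementary_pair_image disjoint)
  moreover have "card (joins (image f ` A) (image g ` B)) = card A * card B" for A B
    by (simp only: card_joins disjoint card_images inj)
  ultimately show ?thesis using pair_sizesI SM SM' by metis
qed

lemma pair_sat_submultiplicative: "pair_sat (m + n + 2) \<le> pair_sat (m + 2) * pair_sat (n + 2)"
proof -
  obtain s t where st: "(s, t) \<in> pair_sizes (m + 2)" "pair_sat (m + 2) = s + t"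
    using pair_sat_attained[of "m + 2"] by auto
  obtain s' t' where st': "(s', t') \<in> pair_sizes (n + 2)" "pair_sat (n + 2) = s' + t'"
    using pair_sat_attained[of "n + 2"] by auto
  have "(s * s', t * t') \<in> pair_sizes (m + n + 2)"
    using pair_sizes_mult[OF st(1) st'(1)] by (simp add: algebra_simps)
  then have "pair_sat (m + n + 2) \<le> s * s' + t * t'" by (rule pair_sat_le)
  also have "\<dots> \<le> (s + t) * (s' + t')" by (simp add: algebra_simps)
  finally show ?thesis using st st' by simp
qed

lemma power_le_pair_sat_square:
  assumes "2 \<le> k"
  shows "2 ^ k \<le> (pair_sat k)\<^sup>2"
proof -
  obtain s m where sm: "(s, m) \<in> pair_sizes k" "pair_sat k = s + m" using pair_sat_attained[OF assms] .
  have "(2::nat) ^ k = 2\<^sup>2 * 2 ^ (k - 2)" using assms by (metis le_add_diff_inverse power_add)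
  also have "\<dots> \<le> 4 * (s * m)"
    using sm(1) complementary_pair.power_le_card_mult by (fastforce simp: pair_sizes_def)
  also have "\<dots> \<le> (s + m)\<^sup>2"
  proof -
    have "real (4 * (s * m)) \<le> real ((s + m)\<^sup>2)"
      using sum_squares_bound[of "real s" "real m"] by (simp add: power2_sum algebra_simps)
    then show ?thesis by (simp only: of_nat_le_iff)
  qed
  finally show ?thesis using sm(2) by simp
qed

lemma pair_sat_pos: "2 \<le> k \<Longrightarrow> 0 < pair_sat k"
  using power_le_pair_sat_square[of k] by (cases "pair_sat k") auto

lemma pair_sizes_six_point_power: "(15 ^ j, 15 ^ j) \<in> pair_sizes (4 * j + 2)"
proof (induction j)
  case 0
  show ?case using power_mem_pair_sizes[of 2] by (simp add: numeral_2_eq_2)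
next
  case (Suc j)
  have "(15, 15) \<in> pair_sizes 6"
    using pair_sizesI[OF complementary_pair_six_point] by (simp add: card_six_point)
  from pair_sizes_mult[OF this Suc] show ?case by (simp add: algebra_simps)
qed

text \<open>The exponent 11 is the least \<open>j\<close> with \<open>2 * 15 ^ j < 2 ^ (4 * j)\<close>.\<close>

lemma pair_sat_46_less: "pair_sat 46 < 2 ^ 44"
proof -
  have "pair_sat 46 \<le> 15 ^ 11 + 15 ^ 11"
    using pair_sat_le[OF pair_sizes_six_point_power[of 11]] by simp
  also have "\<dots> < 2 ^ 44" by simp
  finally show ?thesis .
qed

lemma pair_sat_le_card_of_saturated:
  fixes X :: "nat set"
  assumes "finite X" "saturated_Sperner_system k X F" "2 \<le> k" "2 ^ pair_sat k < card X"
  shows "pair_sat k \<le> card F"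
proof (rule ccontr)
  assume less: "\<not> pair_sat k \<le> card F"
  obtain G where G: "saturated_Sperner_system k X G" "{} \<in> G" "X \<in> G" "card G \<le> card F"
    using saturated_with_empty_and_full[OF assms(1-3)] .
  note GX = saturatedD[OF assms(1) G(1)]
  have "(2::nat) ^ card G \<le> 2 ^ pair_sat k"
    using G(4) less by (intro power_increasing) auto
  then obtain x y where xy: "x \<in> X" "y \<in> X" "x \<noteq> y" "\<And>A. A \<in> G \<Longrightarrow> x \<in> A \<longleftrightarrow> y \<in> A"
    using ex_twins[OF assms(1) GX(2)] assms(4) by (metis le_less_trans)
  have "inj_on ((-) X) {A\<in>G. x \<in> A}"
    using GX(1) by (intro inj_on_compl) auto
  moreover have "card G = card {A\<in>G. x \<notin> A} + card {A\<in>G. x \<in> A}"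
    using GX(2) by (subst card_Un_disjoint[symmetric]) (auto intro: arg_cong[of _ _ card])
  ultimately have "pair_sat k \<le> card G"
    using pair_sat_le[OF pair_sizesI[OF complementary_pair_of_saturated[OF assms(1) G(1-3) xy]]]
    by (simp add: card_image)
  then show False using G(4) less by simp
qed

lemma ex_saturated_card_pair_sat:
  assumes "2 \<le> k"
  shows "\<forall>\<^sub>F n in sequentially. \<exists>(X :: nat set) F.
    finite X \<and> card X = n \<and> saturated_Sperner_system k X F \<and> card F = pair_sat k"
proof -
  obtain s m where sm: "(s, m) \<in> pair_sizes k" "pair_sat k = s + m" using pair_sat_attained[OF assms] .
  then obtain S M :: "nat set set" where SM: "complementary_pair k S M" "pair_sat k = card S + card M"
    by (auto simp: pair_sizes_def)
  interpret complementary_pair k S M by fact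
  define Y where "Y = \<Union>S \<union> \<Union>M"
  have "finite Y" using finite_grounds by (simp add: Y_def)
  have "\<exists>(X :: nat set) F. finite X \<and> card X = n \<and> saturated_Sperner_system k X F \<and> card F = pair_sat k"
    if "card Y < n" for n
  proof -
    have "infinite (- Y)" using \<open>finite Y\<close> by (simp add: Compl_eq_Diff_UNIV)
    then obtain H where H: "finite H" "card H = n - card Y" "H \<subseteq> - Y"
      using infinite_arbitrarily_large by blast
    then have disjoint: "Y \<inter> H = {}" "H \<noteq> {}" using that by auto
    then have "Y \<subset> Y \<union> H" by blast
    then have X: "finite (Y \<union> H)" "card (Y \<union> H) = n" "\<Union>S \<union> \<Union>M \<subset> Y \<union> H"
      using H disjoint(1) that \<open>finite Y\<close> by (simp_all add: card_Un_disjoint flip: Y_def)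
    then show ?thesis
      using saturated_Un_compl[OF X(1,3)] card_Un_compl[OF X(3)] SM(2) by metis
  qed
  then show ?thesis unfolding eventually_sequentially by (intro exI[of _ "Suc (card Y)"]) auto
qed

lemma sat_eq_pair_sat:
  assumes "2 \<le> k"
  shows "\<forall>\<^sub>F n in sequentially. sat n k = pair_sat k"
  using ex_saturated_card_pair_sat[OF assms] eventually_gt_at_top[of "2 ^ pair_sat k"]
proof eventually_elim
  case (elim n)
  show ?case
    unfolding sat_def
  proof (rule cInf_eq_minimum)
    show "pair_sat k \<in> {card F |(X :: nat set) F. finite X \<and> card X = n \<and> saturated_Sperner_system k X F}"
      unfolding mem_Collect_eq using elim(1) by metis
  qed (use pair_sat_le_card_of_saturated assms elim(2) in blast)
qed

lemma sat_lim_eq_pair_sat: "2 \<le> k \<Longrightarrow> sat_lim k = real (pair_sat k)"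
  unfolding sat_lim_def
  using sat_eq_pair_sat[of k] by (intro limI tendsto_eventually) (auto elim: eventually_mono)

lemma sat_one: "sat n 1 = 1"
  unfolding sat_def
proof (rule cInf_eq_minimum)
  have "height (insert Z {{}}) = 2" if "Z \<noteq> {}" for Z :: "nat set"
  proof -
    have sides: "{A \<in> {{}}. A \<subset> Z} = {{}}" "{A \<in> {{}}. Z \<subset> A} = {}" using that by auto
    show ?thesis using height_insert[of "{{}}" Z] unfolding sides
      by (simp add: height_insert[of "{}"])
  qed
  then have "saturated_Sperner_system 1 {..<n} {{}}"
    by (auto simp: saturated_iff_height height_insert[of "{}"])
  moreover have "card {{} :: nat set} = 1" by simp
  ultimately show "1 \<in> {card F |(X :: nat set) F. finite X \<and> card X = n \<and> saturated_Sperner_system 1 X F}"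
    unfolding mem_Collect_eq by (metis card_lessThan finite_lessThan)
next
  fix m assume "m \<in> {card F |(X :: nat set) F. finite X \<and> card X = n \<and> saturated_Sperner_system 1 X F}"
  then obtain X :: "nat set" and F where X: "finite X" "saturated_Sperner_system 1 X F" "m = card F"
    by blast
  have "F \<noteq> {}"
  proof
    assume "F = {}"
    then have "1 < height {{} :: nat set}" using saturatedD(4)[OF X(1,2), of "{}"] by simp
    then show False by (simp add: height_insert)
  qed
  moreover have "finite F" using saturatedD(2)[OF X(1,2)] .
  ultimately show "1 \<le> m" using X(3) by (simp add: Suc_le_eq card_gt_0_iff)
qed

lemma sat_lim_one: "sat_lim 1 = 1"
  by (simp add: sat_lim_def sat_one del: One_nat_def)

section \<open>Growth rate\<close>

lemma subadditive_div_mod: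
  fixes a :: "nat \<Rightarrow> real"
  assumes "\<And>m n. a (m + n) \<le> a m + a n"
  shows "a n \<le> real (n div m) * a m + a (n mod m)"
proof -
  have "a (q * m + r) \<le> real q * a m + a r" for q r
  proof (induction q)
    case (Suc q)
    have "a (Suc q * m + r) \<le> a m + a (q * m + r)"
      using assms[of m "q * m + r"] by (simp add: algebra_simps)
    then show ?case using Suc by (simp add: algebra_simps)
  qed simp
  then show ?thesis by (metis div_mult_mod_eq)
qed

lemma Fekete_subadditive:
  fixes a :: "nat \<Rightarrow> real"
  assumes subadditive: "\<And>m n. a (m + n) \<le> a m + a n"
    and bdd: "bdd_below ((\<lambda>n. a n / real n) ` {1..})"
  shows "(\<lambda>n. a n / real n) \<longlonglongrightarrow> (INF n\<in>{1..}. a n / real n)"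
proof (rule order_tendstoI)
  fix x assume "x < (INF n\<in>{1..}. a n / real n)"
  then have "x < a n / real n" if "1 \<le> n" for n using cINF_lower[OF bdd, of n] that by simp
  then show "\<forall>\<^sub>F n in sequentially. x < a n / real n" by (auto simp: eventually_sequentially)
next
  fix x assume "(INF n\<in>{1..}. a n / real n) < x"
  then obtain m where m: "1 \<le> m" "a m / real m < x" using cINF_less_iff[OF _ bdd] by auto
  define t where "t = a m / real m"
  define K where "K = (\<Sum>r<m. \<bar>a r - real r * t\<bar>)"
  have bound: "a n / real n \<le> t + K / real n" if "1 \<le> n" for n
  proof -
    have "real n = real (n div m) * real m + real (n mod m)"
      by (metis div_mult_mod_eq of_nat_add of_nat_mult)
    then have "real n * t = real (n div m) * (real m * t) + real (n mod m) * t"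
      by (simp only: distrib_right mult.assoc)
    also have "real m * t = a m" using m(1) by (simp add: t_def)
    finally have "a n \<le> real n * t + (a (n mod m) - real (n mod m) * t)"
      using subadditive_div_mod[OF subadditive, of n m] by simp
    also have "a (n mod m) - real (n mod m) * t \<le> \<bar>a (n mod m) - real (n mod m) * t\<bar>" by simp
    also have "\<dots> \<le> K" unfolding K_def using m(1) by (intro member_le_sum) auto
    finally show ?thesis using that by (simp add: field_simps)
  qed
  have "(\<lambda>n. t + K / real n) \<longlonglongrightarrow> t + 0" by (intro tendsto_intros lim_const_over_n)
  then have "\<forall>\<^sub>F n in sequentially. t + K / real n < x"
    using m(2) by (intro order_tendstoD(2)) (auto simp: t_def)
  then show "\<forall>\<^sub>F n in sequentially. a n / real n < x"
    using eventually_ge_at_top[of 1] by eventually_elim (use bound in \<open>blast intro: le_less_trans\<close>)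
qed

lemma tendsto_div_shift:
  fixes a :: "nat \<Rightarrow> real"
  assumes "(\<lambda>n. a n / real n) \<longlonglongrightarrow> c"
  shows "(\<lambda>n. a n / real (n + m)) \<longlonglongrightarrow> c"
proof -
  have "(\<lambda>n. 1 - real m / real (n + m)) \<longlonglongrightarrow> 1 - 0"
    by (intro tendsto_diff tendsto_const lim_const_over_n
        LIMSEQ_ignore_initial_segment[of "\<lambda>n. real m / real n"])
  then have "(\<lambda>n. a n / real n * (1 - real m / real (n + m))) \<longlonglongrightarrow> c * (1 - 0)"
    by (intro tendsto_mult assms)
  moreover have "\<forall>\<^sub>F n in sequentially. a n / real n * (1 - real m / real (n + m)) = a n / real (n + m)"
    using eventually_ge_at_top[of 1] by eventually_elim (simp add: field_simps)
  ultimately show ?thesis by (simp add: tendsto_cong)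
qed

definition log_pair_sat :: "nat \<Rightarrow> real" where
  "log_pair_sat n = log 2 (real (pair_sat (n + 2)))"

lemma log_pair_sat_subadditive: "log_pair_sat (m + n) \<le> log_pair_sat m + log_pair_sat n"
proof -
  have "real (pair_sat (m + n + 2)) \<le> real (pair_sat (m + 2)) * real (pair_sat (n + 2))"
    using pair_sat_submultiplicative[of m n] by (metis of_nat_le_iff of_nat_mult)
  then have "log_pair_sat (m + n) \<le> log 2 (real (pair_sat (m + 2)) * real (pair_sat (n + 2)))"
    unfolding log_pair_sat_def using pair_sat_pos by (subst log_le_cancel_iff) auto
  also have "\<dots> = log_pair_sat m + log_pair_sat n"
    unfolding log_pair_sat_def using pair_sat_pos[of "m + 2"] pair_sat_pos[of "n + 2"]
    by (simp add: log_mult)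
  finally show ?thesis .
qed

lemma half_le_log_pair_sat: "real n / 2 \<le> log_pair_sat n"
proof -
  have "2 ^ (n + 2) \<le> (real (pair_sat (n + 2)))\<^sup>2"
    using power_le_pair_sat_square[of "n + 2"]
    by (metis le_add2 of_nat_le_iff of_nat_numeral of_nat_power)
  then have "log 2 (2 ^ (n + 2)) \<le> log 2 ((real (pair_sat (n + 2)))\<^sup>2)"
    using pair_sat_pos[of "n + 2"] by (subst log_le_cancel_iff) auto
  moreover have "log 2 ((real (pair_sat (n + 2)))\<^sup>2) = 2 * log_pair_sat n"
    using pair_sat_pos[of "n + 2"] by (simp add: log_pair_sat_def log_nat_power)
  ultimately show ?thesis using log_pow_cancel[of 2 "n + 2"] by linarith
qed

lemma log_pair_sat_44_less: "log_pair_sat 44 < 44"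
proof -
  have "real (pair_sat 46) < 2 ^ 44"
    using pair_sat_46_less by (metis of_nat_less_iff of_nat_numeral of_nat_power)
  then have "log_pair_sat 44 < log 2 (2 ^ 44)"
    unfolding log_pair_sat_def using pair_sat_pos[of 46] by (subst log_less_cancel_iff) auto
  then show ?thesis using log_pow_cancel[of 2 44] by linarith
qed

lemma log_sat_lim_tendsto:
  obtains c where "(\<lambda>k. log 2 (sat_lim k) / real k) \<longlonglongrightarrow> c" "1 / 2 \<le> c" "c < 1"
proof -
  define c where "c = (INF n\<in>{1..}. log_pair_sat n / real n)"
  have ge: "1 / 2 \<le> log_pair_sat n / real n" if "1 \<le> n" for n
    using half_le_log_pair_sat[of n] that by (simp add: field_simps)
  then have bdd: "bdd_below ((\<lambda>n. log_pair_sat n / real n) ` {1..})"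
    by (intro bdd_belowI2[of _ "1 / 2"]) simp_all
  have "(\<lambda>n. log_pair_sat n / real n) \<longlonglongrightarrow> c"
    unfolding c_def by (rule Fekete_subadditive[OF log_pair_sat_subadditive bdd])
  then have "(\<lambda>n. log 2 (sat_lim (n + 2)) / real (n + 2)) \<longlonglongrightarrow> c"
    using tendsto_div_shift[of log_pair_sat c 2] by (simp add: log_pair_sat_def sat_lim_eq_pair_sat)
  then have "(\<lambda>k. log 2 (sat_lim k) / real k) \<longlonglongrightarrow> c" by (rule LIMSEQ_offset)
  moreover have "1 / 2 \<le> c" unfolding c_def using ge by (intro cINF_greatest) auto
  moreover have "c \<le> log_pair_sat 44 / real 44" unfolding c_def using bdd by (rule cINF_lower) simp
  then have "c < 1" using log_pair_sat_44_less by simp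
  ultimately show thesis by (rule that)
qed

lemma sat_lim_pos_less_power:
  assumes "1 \<le> k"
  shows "0 < sat_lim k" "sat_lim k < 2 ^ k"
proof -
  consider "k = 1" | "2 \<le> k" using assms by linarith
  then have "0 < sat_lim k \<and> sat_lim k < 2 ^ k"
  proof cases
    case 1
    then show ?thesis by (simp add: sat_lim_one del: One_nat_def)
  next
    case 2
    then have "real (pair_sat k) < 2 ^ k"
      using pair_sat_less_power by (metis of_nat_less_iff of_nat_numeral of_nat_power)
    then show ?thesis using 2 pair_sat_pos by (simp add: sat_lim_eq_pair_sat)
  qed
  then show "0 < sat_lim k" "sat_lim k < 2 ^ k" by simp_all
qed

lemma uniform_powr_bound_of_growth_rate:
  fixes f :: "nat \<Rightarrow> real"
  assumes "1 < B" and lim: "(\<lambda>k. log B (f k) / real k) \<longlonglongrightarrow> c" and "c < 1"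
    and pos: "\<And>k. 1 \<le> k \<Longrightarrow> 0 < f k" and less: "\<And>k. 1 \<le> k \<Longrightarrow> f k < B ^ k"
  obtains \<epsilon> where "0 < \<epsilon>" "c \<le> 1 - \<epsilon>" "\<And>k. 1 \<le> k \<Longrightarrow> f k \<le> B powr ((1 - \<epsilon>) * real k)"
proof -
  define b where "b k = log B (f k) / real k" for k
  have f_eq: "f k = B powr (b k * real k)" if "1 \<le> k" for k
    using that pos[OF that] \<open>1 < B\<close> by (simp add: b_def)
  have b_less: "b k < 1" if "1 \<le> k" for k
  proof -
    have "B powr (b k * real k) < B powr real k"
      using f_eq[OF that] less[OF that] \<open>1 < B\<close> by (simp add: powr_realpow)
    then show ?thesis using that \<open>1 < B\<close> by simp
  qed
  have "\<forall>\<^sub>F k in sequentially. b k < (1 + c) / 2"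
    using lim \<open>c < 1\<close> unfolding b_def by (intro order_tendstoD(2)) auto
  then obtain K where K: "\<And>k. K \<le> k \<Longrightarrow> b k < (1 + c) / 2" by (auto simp: eventually_sequentially)
  define d where "d = Max (insert ((1 + c) / 2) (b ` {1..<K}))"
  have "d < 1" unfolding d_def using \<open>c < 1\<close> b_less by (subst Max_less_iff) auto
  moreover have d: "(1 + c) / 2 \<le> d" unfolding d_def by (intro Max_ge) auto
  moreover have "f k \<le> B powr (d * real k)" if "1 \<le> k" for k
  proof -
    have "b k \<le> d"
    proof (cases "K \<le> k")
      case True
      then show ?thesis using K[OF True] d by linarith
    next
      case False
      then show ?thesis unfolding d_def using that by (intro Max_ge) auto
    qed
    then show ?thesis using f_eq[OF that] \<open>1 < B\<close> by (simp add: mult_right_mono)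
  qed
  ultimately show thesis using \<open>c < 1\<close> by (intro that[of "1 - d"]) auto
qed

lemma powr_form_of_growth_rate:
  fixes f :: "nat \<Rightarrow> real"
  assumes "1 < B" and lim: "(\<lambda>k. log B (f k) / real k) \<longlonglongrightarrow> c" and "c \<noteq> 0"
    and pos: "\<And>k. 1 \<le> k \<Longrightarrow> 0 < f k"
  obtains \<delta> :: "nat \<Rightarrow> real" where "\<delta> \<in> o(\<lambda>_. 1)"
    "\<forall>\<^sub>F k in sequentially. f k = B powr ((1 + \<delta> k) * c * real k)"
proof
  let ?\<delta> = "\<lambda>k. log B (f k) / real k / c - 1"
  have "?\<delta> \<longlonglongrightarrow> c / c - 1" using \<open>c \<noteq> 0\<close> by (intro tendsto_intros lim)
  then show "?\<delta> \<in> o(\<lambda>_. 1)" using \<open>c \<noteq> 0\<close> by (intro smalloI_tendsto) auto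
  show "\<forall>\<^sub>F k in sequentially. f k = B powr ((1 + ?\<delta> k) * c * real k)"
    using eventually_ge_at_top[of 1]
    by eventually_elim (use pos \<open>c \<noteq> 0\<close> \<open>1 < B\<close> in simp)
qed

theorem theorem1p4:
  "\<exists>\<epsilon>::real. \<epsilon> > 0 \<and>
     (\<exists>c::real. c \<in> {1/2..1 - \<epsilon>} \<and>
        (\<forall>k::nat. k \<ge> 1 \<longrightarrow> sat_lim k \<le> 2 powr ((1 - \<epsilon>) * real k)) \<and>
        (\<exists>\<delta> :: nat \<Rightarrow> real. \<delta> \<in> o(\<lambda>_. 1) \<and>
           (\<forall>\<^sub>F k in sequentially. sat_lim k = 2 powr ((1 + \<delta> k) * c * real k))))"
proof -
  obtain c where lim: "(\<lambda>k. log 2 (sat_lim k) / real k) \<longlonglongrightarrow> c" and c: "1 / 2 \<le> c" "c < 1"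
    by (rule log_sat_lim_tendsto)
  obtain \<epsilon> where \<epsilon>: "0 < \<epsilon>" "c \<le> 1 - \<epsilon>" "\<And>k. 1 \<le> k \<Longrightarrow> sat_lim k \<le> 2 powr ((1 - \<epsilon>) * real k)"
    using uniform_powr_bound_of_growth_rate[OF _ lim c(2) sat_lim_pos_less_power] by auto
  obtain \<delta> :: "nat \<Rightarrow> real" where "\<delta> \<in> o(\<lambda>_. 1)"
    "\<forall>\<^sub>F k in sequentially. sat_lim k = 2 powr ((1 + \<delta> k) * c * real k)"
    using powr_form_of_growth_rate[OF _ lim _ sat_lim_pos_less_power(1)] c(1) by auto
  moreover have "c \<in> {1/2..1 - \<epsilon>}" using c(1) \<epsilon>(2) by simp
  ultimately show ?thesis using \<epsilon>(1,3) by blast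
qed

end
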